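(* Let $R$ be a $\ast$-ring. If $R$ is $\ast$-regular and abelian, then every element $a$ of $R$ can be written as $a=u+p$ where $u$ is a unit and $p$ is a projection such that $aR\cap pR=0$.
   Context: All rings are associative and unital. A $\ast$-ring is a ring $R$ with a map $\ast:R\to R$ with $(x+y)^\ast=x^\ast+y^\ast$, $(xy)^\ast=y^\ast x^\ast$, $(x^\ast)^\ast=x$. A projection is an element $p$ with $p^\ast=p=p^2$. A $\ast$-ring $R$ is $\ast$-regular if $R$ is von Neumann regular and the involution is proper ($x^\ast x=0$ implies $x=0$); equivalently, $R$ is von Neumann regular and for every $x\in R$ there is a projection $p$ with $xR=pR$. A ring is abelian if every idempotent is central. *)

theory Defs
  imports "HOL-Algebra.Algebra"
begin

locale star_ring = ring R for R (structure) +
  fixes star :: "'a \<Rightarrow> 'a"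
  assumes star_closed: "x \<in> carrier R \<Longrightarrow> star x \<in> carrier R"
    and star_add: "\<lbrakk>x \<in> carrier R; y \<in> carrier R\<rbrakk> \<Longrightarrow> star (x \<oplus> y) = star x \<oplus> star y"
    and star_mult: "\<lbrakk>x \<in> carrier R; y \<in> carrier R\<rbrakk> \<Longrightarrow> star (x \<otimes> y) = star y \<otimes> star x"
    and star_star: "x \<in> carrier R \<Longrightarrow> star (star x) = x"

definition projection :: "('a, 'm) ring_scheme \<Rightarrow> ('a \<Rightarrow> 'a) \<Rightarrow> 'a \<Rightarrow> bool" where
  "projection R star p \<longleftrightarrow> p \<in> carrier R \<and> star p = p \<and> p \<otimes>\<^bsub>R\<^esub> p = p"

definition von_Neumann_regular :: "('a, 'm) ring_scheme \<Rightarrow> bool" where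
  "von_Neumann_regular R \<longleftrightarrow>
     (\<forall>x\<in>carrier R. \<exists>y\<in>carrier R. x \<otimes>\<^bsub>R\<^esub> y \<otimes>\<^bsub>R\<^esub> x = x)"

definition proper_involution :: "('a, 'm) ring_scheme \<Rightarrow> ('a \<Rightarrow> 'a) \<Rightarrow> bool" where
  "proper_involution R star \<longleftrightarrow>
     (\<forall>x\<in>carrier R. star x \<otimes>\<^bsub>R\<^esub> x = \<zero>\<^bsub>R\<^esub> \<longrightarrow> x = \<zero>\<^bsub>R\<^esub>)"

definition star_regular :: "('a, 'm) ring_scheme \<Rightarrow> ('a \<Rightarrow> 'a) \<Rightarrow> bool" where
  "star_regular R star \<longleftrightarrow> von_Neumann_regular R \<and> proper_involution R star"

(* "Abelian" in the ring-theoretic sense: multiplication need not commute. *)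
definition abelian_ring :: "('a, 'm) ring_scheme \<Rightarrow> bool" where
  "abelian_ring R \<longleftrightarrow>
     (\<forall>e\<in>carrier R. e \<otimes>\<^bsub>R\<^esub> e = e \<longrightarrow>
        (\<forall>x\<in>carrier R. e \<otimes>\<^bsub>R\<^esub> x = x \<otimes>\<^bsub>R\<^esub> e))"

(* The left coset a <# carrier R of the multiplicative monoid is the principal right ideal aR. *)
definition principal_right_ideal :: "('a, 'm) ring_scheme \<Rightarrow> 'a \<Rightarrow> 'a set" where
  "principal_right_ideal R a = a <#\<^bsub>R\<^esub> carrier R"

end

theory Submission
  imports Defs
begin

text \<open>
  In an abelian regular ring every element \<open>a\<close> lives in a single corner, where it is invertible:
  if \<open>a \<otimes> y \<otimes> a = a\<close>, the idempotents \<open>a \<otimes> y\<close> and \<open>y \<otimes> a\<close> are central, and this forces them to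
  be the same idempotent \<open>e\<close>, an identity for \<open>a\<close>. Thus \<open>R\<close> is the product of the corners
  \<open>e \<otimes> R\<close> and \<open>(\<one> \<ominus> e) \<otimes> R\<close>, and \<open>a\<close> is a unit in the first and zero in the second
  (\<open>abelian_regular_group_inverse\<close>). Put \<open>p = \<one> \<ominus> e\<close>. Then \<open>a \<ominus> p\<close> is a unit of \<open>R\<close>, being
  \<open>a\<close> on the first corner and \<open>\<ominus> \<one>\<close> on the second (\<open>unit_of_group_inverse\<close>), and
  \<open>aR \<inter> pR \<subseteq> eR \<inter> pR = 0\<close>.

  The involution enters only to make \<open>p\<close> a projection. For a central idempotent \<open>e\<close> the element
  \<open>(\<one> \<ominus> star e) \<otimes> e\<close> measures the failure of \<open>e = star e \<otimes> e\<close>; its norm is a multiple of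
  \<open>star e \<otimes> (\<one> \<ominus> star e) = \<zero>\<close>, so properness kills it (\<open>idempotent_is_projection\<close>).
\<close>

lemma (in ring) idempotent_orthogonal_complement:
  assumes e: "e \<in> carrier R" "e \<otimes> e = e"
  shows "e \<otimes> (\<one> \<ominus> e) = \<zero>" "(\<one> \<ominus> e) \<otimes> e = \<zero>" "(\<one> \<ominus> e) \<otimes> (\<one> \<ominus> e) = \<one> \<ominus> e"
  using e by (simp_all add: a_minus_def l_distr r_distr r_minus l_minus r_neg)

text \<open>
  For idempotents, being self-adjoint is the same as \<open>e = star e \<otimes> e\<close>, because the right-hand
  side is self-adjoint.
\<close>

lemma (in star_ring) idempotent_is_projection:
  assumes proper: "proper_involution R star" and abelian: "abelian_ring R"
    and e: "e \<in> carrier R" "e \<otimes> e = e"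
  shows "projection R star e"
proof -
  have s: "star e \<in> carrier R" "star e \<otimes> star e = star e"
    using e star_closed star_mult[of e e] by simp_all
  define x where "x = (\<one> \<ominus> star e) \<otimes> e"
  have x: "x \<in> carrier R" using e s by (simp add: x_def)
  have "star x \<otimes> x = star (\<one> \<ominus> star e) \<otimes> (star e \<otimes> (\<one> \<ominus> star e)) \<otimes> e"
  proof -
    have x': "x = e \<otimes> (\<one> \<ominus> star e)"
      using abelian e s unfolding abelian_ring_def x_def by (metis minus_closed one_closed)
    have "star x = star (\<one> \<ominus> star e) \<otimes> star e"
      using e s by (simp add: x' star_mult)
    then show ?thesis using e s star_closed by (simp add: x_def m_assoc)
  qed
  also have "\<dots> = \<zero>"
    using e s star_closed by (simp add: idempotent_orthogonal_complement)
  finally have "x = \<zero>" using proper x by (simp add: proper_involution_def)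
  then have "e \<ominus> star e \<otimes> e = \<zero>"
    using e s by (simp add: x_def a_minus_def l_distr l_minus)
  then have "e = star e \<otimes> e" using e s by (simp add: r_right_minus_eq)
  moreover from this have "star e = star e \<otimes> e"
    using e s star_mult[of "star e" e] star_star[of e] by simp
  ultimately show ?thesis using e by (simp add: projection_def)
qed

text \<open>
  Write \<open>e = a \<otimes> y\<close> and \<open>f = y \<otimes> a\<close>. From \<open>a = a \<otimes> f\<close> and centrality of \<open>f\<close>, the product
  \<open>a \<otimes> y\<close> absorbs \<open>f\<close>; from \<open>a = e \<otimes> a\<close> and centrality of \<open>e\<close>, the product \<open>y \<otimes> a\<close> absorbs
  \<open>e\<close>. Hence \<open>e = f \<otimes> e = f\<close>. Cutting \<open>y\<close> down to the corner
  of \<open>e\<close> makes it the inverse of \<open>a\<close> there.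
\<close>

lemma (in ring) abelian_regular_group_inverse:
  assumes regular: "von_Neumann_regular R" and abelian: "abelian_ring R"
    and a: "a \<in> carrier R"
  obtains e y where "e \<in> carrier R" "y \<in> carrier R" "e \<otimes> e = e"
    "a \<otimes> y = e" "y \<otimes> a = e" "e \<otimes> a = a" "a \<otimes> e = a" "e \<otimes> y = y" "y \<otimes> e = y"
proof -
  obtain y where y: "y \<in> carrier R" and aya: "a \<otimes> y \<otimes> a = a"
    using regular a by (auto simp: von_Neumann_regular_def)
  define e where "e = a \<otimes> y"
  define f where "f = y \<otimes> a"
  have cl: "e \<in> carrier R" "f \<in> carrier R" using a y by (simp_all add: e_def f_def)
  have ea: "e \<otimes> a = a" and af: "a \<otimes> f = a"
    using a y aya by (simp_all add: e_def f_def m_assoc)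
  have ee: "e \<otimes> e = e"
    using a y cl ea by (simp add: e_def flip: m_assoc)
  have ff: "f \<otimes> f = f"
    using a y cl af by (simp add: f_def m_assoc)
  have ec: "e \<otimes> x = x \<otimes> e" and fc: "f \<otimes> x = x \<otimes> f" if "x \<in> carrier R" for x
    using abelian cl ee ff that unfolding abelian_ring_def by blast+
  have "e = f \<otimes> e"
    using a y cl af fc[OF a] by (simp add: e_def flip: m_assoc)
  moreover have "f = f \<otimes> e"
    using a y cl ea ec[OF a] by (simp add: f_def m_assoc)
  ultimately have fe: "y \<otimes> a = e" by (simp add: f_def)
  have ae: "a \<otimes> e = a" using ea ec[OF a] by simp
  show ?thesis
  proof (rule that[of e "y \<otimes> e"])
    show "a \<otimes> (y \<otimes> e) = e" using a y cl ee by (simp add: e_def flip: m_assoc)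
    show "y \<otimes> e \<otimes> a = e" using a y cl ea fe by (simp add: m_assoc)
    show "e \<otimes> (y \<otimes> e) = y \<otimes> e"
      using y cl ee ec[of "y \<otimes> e"] by (simp add: m_assoc)
    show "y \<otimes> e \<otimes> e = y \<otimes> e" using y cl ee by (simp add: m_assoc)
  qed (use a y cl ee ea ae in simp_all)
qed

lemma (in ring) mult_minus_orthogonal_idempotent:
  assumes "a \<in> carrier R" "y \<in> carrier R" "p \<in> carrier R"
    and "a \<otimes> p = \<zero>" "p \<otimes> y = \<zero>" "p \<otimes> p = p"
  shows "(a \<ominus> p) \<otimes> (y \<ominus> p) = a \<otimes> y \<oplus> p"
  using assms by (simp add: a_minus_def l_distr r_distr l_minus r_minus)

text \<open>
  On the complementary corner \<open>\<ominus> \<one>\<close> is its own inverse, so the inverse of \<open>a \<ominus> (\<one> \<ominus> e)\<close> is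
  built from the group inverse \<open>y\<close> by the same formula.
\<close>

lemma (in ring) unit_of_group_inverse:
  assumes cl: "a \<in> carrier R" "y \<in> carrier R" "e \<in> carrier R" and ee: "e \<otimes> e = e"
    and inverse: "a \<otimes> y = e" "y \<otimes> a = e"
    and corner: "e \<otimes> a = a" "a \<otimes> e = a" "e \<otimes> y = y" "y \<otimes> e = y"
  shows "a \<ominus> (\<one> \<ominus> e) \<in> Units R"
proof -
  let ?p = "\<one> \<ominus> e"
  have p: "?p \<in> carrier R" "?p \<otimes> ?p = ?p"
    using cl ee by (simp_all add: idempotent_orthogonal_complement)
  have zero: "a \<otimes> ?p = \<zero>" "?p \<otimes> a = \<zero>" "y \<otimes> ?p = \<zero>" "?p \<otimes> y = \<zero>"
    using cl corner by (simp_all add: a_minus_def l_distr r_distr l_minus r_minus r_neg)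
  have one: "e \<oplus> ?p = \<one>"
    using cl by (simp add: a_minus_def a_comm[of e] a_assoc l_neg)
  have "(a \<ominus> ?p) \<otimes> (y \<ominus> ?p) = \<one>" "(y \<ominus> ?p) \<otimes> (a \<ominus> ?p) = \<one>"
    using cl p zero one inverse by (simp_all add: mult_minus_orthogonal_idempotent)
  then show ?thesis using cl by (auto simp: Units_def intro!: bexI[of _ "y \<ominus> ?p"])
qed

lemma (in ring) principal_right_ideals_inter_zero:
  assumes cl: "a \<in> carrier R" "p \<in> carrier R" "e \<in> carrier R"
    and "e \<otimes> a = a" "e \<otimes> p = \<zero>"
  shows "principal_right_ideal R a \<inter> principal_right_ideal R p = {\<zero>}"
proof -
  have "a \<otimes> r = \<zero>" if r: "r \<in> carrier R" and s: "s \<in> carrier R" and eq: "a \<otimes> r = p \<otimes> s" for r s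
  proof -
    have "a \<otimes> r = e \<otimes> (a \<otimes> r)" using assms r by (simp flip: m_assoc)
    also have "\<dots> = \<zero>" using assms s by (simp add: eq flip: m_assoc)
    finally show ?thesis .
  qed
  moreover have "\<exists>r\<in>carrier R. \<zero> = x \<otimes> r" if "x \<in> carrier R" for x
    using that by (intro bexI[of _ \<zero>]) simp_all
  ultimately show ?thesis
    using cl unfolding principal_right_ideal_def l_coset_def by fastforce
qed

theorem proposition6:
  fixes R :: "('a, 'm) ring_scheme" and star :: "'a \<Rightarrow> 'a"
  assumes "star_ring R star"
    and "star_regular R star"
    and "abelian_ring R"
  shows "\<forall>a\<in>carrier R. \<exists>u p. u \<in> Units R \<and> projection R star p \<and> a = u \<oplus>\<^bsub>R\<^esub> p \<and>
           principal_right_ideal R a \<inter> principal_right_ideal R p = {\<zero>\<^bsub>R\<^esub>}"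
proof
  fix a assume a: "a \<in> carrier R"
  interpret star_ring R star by fact
  have regular: "von_Neumann_regular R" and proper: "proper_involution R star"
    using assms(2) by (simp_all add: star_regular_def)
  obtain e y where ey: "e \<in> carrier R" "y \<in> carrier R" "e \<otimes>\<^bsub>R\<^esub> e = e"
    "a \<otimes>\<^bsub>R\<^esub> y = e" "y \<otimes>\<^bsub>R\<^esub> a = e" "e \<otimes>\<^bsub>R\<^esub> a = a" "a \<otimes>\<^bsub>R\<^esub> e = a" "e \<otimes>\<^bsub>R\<^esub> y = y" "y \<otimes>\<^bsub>R\<^esub> e = y"
    using abelian_regular_group_inverse[OF regular assms(3) a] by blast
  let ?p = "\<one>\<^bsub>R\<^esub> \<ominus>\<^bsub>R\<^esub> e"
  have "a \<ominus>\<^bsub>R\<^esub> ?p \<in> Units R"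
    using a ey by (intro unit_of_group_inverse[of a y e])
  moreover have "projection R star ?p"
    using ey idempotent_is_projection[OF proper assms(3)]
    by (simp add: idempotent_orthogonal_complement)
  moreover have "a = (a \<ominus>\<^bsub>R\<^esub> ?p) \<oplus>\<^bsub>R\<^esub> ?p"
    using a ey by (simp add: a_minus_def a_assoc l_neg)
  moreover have "principal_right_ideal R a \<inter> principal_right_ideal R ?p = {\<zero>\<^bsub>R\<^esub>}"
    using a ey
    by (intro principal_right_ideals_inter_zero[of a ?p e])
      (simp_all add: idempotent_orthogonal_complement)
  ultimately show "\<exists>u p. u \<in> Units R \<and> projection R star p \<and> a = u \<oplus>\<^bsub>R\<^esub> p \<and>
      principal_right_ideal R a \<inter> principal_right_ideal R p = {\<zero>\<^bsub>R\<^esub>}"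
    by blast
qed

end
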